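(* Let $(X,\mathcal T)$ be a second-countable Brown Hausdorff topological space. Then there exists a topology $\mathcal T'$ on $X$ which is an open refinement of $\mathcal T$ and such that the topological space $X'=(X,\mathcal T')$ is Brown, anticompact, and strongly rigid. Moreover, $\mathcal T'$ can be chosen so that in addition every continuous map $f:C\to X'$ from a vertex-connected subspace $C$ of $X'$ to $X'$ is either constant or else $f$ is the identity embedding of $C$ into $X'$ (i.e. $f(c)=c$ for all $c\in C$).
   Context: A topological space $X$ is called: - Brown if for any nonempty open sets $U,V\subseteq X$ the intersection $\overline U\cap\overline V$ of their closures is infinite; - anticompact if every compact subspace of $X$ is finite; - strongly rigid if every continuous map $f:X\to X$ that is not the identity map of $X$ is constant; - vertex-connected if $X$ is connected and for every $x\in X$ the subspace $X\setminus\{x\}$ is connected (connected means: not the union of two disjoint nonempty open subsets; the empty space counts as connected). A topology $\mathcal T'$ on a topological space $(X,\mathcal T)$ is called an open refinement of $\mathcal T$ if for all $V\in\mathcal T$, $V'\in\mathcal T'$ and every point $x\in V\cap V'$ there exists $U\in\mathcal T$ such that $U\subseteq V\cap V'$ and $\{x\}\cup U\in\mathcal T'$. (This implies $\mathcal T\subseteq\mathcal T'$.) *)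

theory Defs
  imports "HOL-Analysis.Analysis"
begin

definition brown_space :: "'a topology \<Rightarrow> bool" where
  "brown_space X \<longleftrightarrow>
     (\<forall>U V. openin X U \<and> openin X V \<and> U \<noteq> {} \<and> V \<noteq> {} \<longrightarrow>
        infinite ((X closure_of U) \<inter> (X closure_of V)))"

definition anticompact_space :: "'a topology \<Rightarrow> bool" where
  "anticompact_space X \<longleftrightarrow> (\<forall>K. compactin X K \<longrightarrow> finite K)"

(* Only the values of f on the carrier of X matter, so "f is the identity map of X"
   is stated pointwise on topspace X. *)
definition strongly_rigid_space :: "'a topology \<Rightarrow> bool" where
  "strongly_rigid_space X \<longleftrightarrow>
     (\<forall>f. continuous_map X X f \<and> \<not> (\<forall>x\<in>topspace X. f x = x) \<longrightarrow>
        f constant_on topspace X)"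

definition vertex_connected_space :: "'a topology \<Rightarrow> bool" where
  "vertex_connected_space X \<longleftrightarrow>
     connected_space X \<and>
     (\<forall>x\<in>topspace X. connected_space (subtopology X (topspace X - {x})))"

(* The topology T' on the carrier of T is an open refinement of T. The set U below is
   allowed to be empty. *)
definition open_refinement :: "'a topology \<Rightarrow> 'a topology \<Rightarrow> bool" where
  "open_refinement T T' \<longleftrightarrow>
     topspace T' = topspace T \<and>
     (\<forall>V V' x. openin T V \<and> openin T' V' \<and> x \<in> V \<inter> V' \<longrightarrow>
        (\<exists>U. openin T U \<and> U \<subseteq> V \<inter> V' \<and> openin T' ({x} \<union> U)))"

end

theory Submission
  imports Defs
begin

text \<open>
  The refinement keeps, around each point \<open>x\<close>, only \<open>most\<close> members of a sequence
  \<open>U x 0, U x 1, \<dots>\<close> of disjoint open sets converging to \<open>x\<close>: a set \<open>G\<close> is open in the new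
  topology when for each \<open>x \<in> G\<close> the indices \<open>n\<close> with \<open>\<not> U x n \<subseteq> G\<close> form a small set, small
  meaning membership in a proper ideal \<open>I x\<close> on the naturals that contains the finite sets. The
  three required properties come from three independent features of this scheme.

  \<^item> Brown: each set \<open>U x n\<close> is chosen to meet each of the basic open sets numbered \<open>0, \<dots>, n\<close>
    that has \<open>x\<close> in its closure. Then basic open sets keep their closures
    (lemma \<open>closure_of_refined\<close>), and every nonempty open set of the refinement contains a basic
    one.

  \<^item> Anticompact: \<open>I x\<close> is tall, that is, each infinite set of indices has an infinite subset in
    \<open>I x\<close> (lemma \<open>infinite_block_sparse_subset\<close>). An infinite compact set would accumulate at
    some \<open>x\<close>; selecting its points from the \<open>U x n\<close> with \<open>n\<close> in an infinite small set gives an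
    infinite subset without accumulation point (lemma \<open>anticompact_refined\<close>).

  \<^item> Rigid: the ideals at distinct points are incomparable in the sense of Katetov, even after
    restriction to positive sets (lemma \<open>almost_disjoint_block_sparse_incomparable\<close>). If \<open>f\<close> is
    continuous at \<open>x\<close>, \<open>y = f x \<noteq> x\<close> and \<open>f\<close> takes values other than \<open>y\<close> arbitrarily close to
    \<open>x\<close>, then choosing points of \<open>U x n\<close> with images in \<open>U y (m n)\<close> produces an index map \<open>m\<close>
    that reduces \<open>I y\<close> to \<open>I x\<close>. Hence \<open>f\<close> is locally constant at every point it moves
    (lemma \<open>locally_constant_off_fixpoints\<close>). If \<open>f\<close> moves \<open>c\<close> to \<open>y\<close>, the fibre of \<open>y\<close>
    is therefore open and closed in the domain with \<open>y\<close> deleted, which is connected for a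
    vertex-connected domain, so \<open>f\<close> is constant. A Brown \<open>T\<^sub>1\<close> space is itself
    vertex-connected, which gives strong rigidity.

  A second-countable Hausdorff space has at most continuum many points, so what is needed is a
  family of that many tall, pairwise incomparable ideals. Incomparable ultrafilters would do, but
  the explicit ideals below, indexed by almost disjoint sets of naturals, avoid any transfinite
  construction.
\<close>
section \<open>Ideals of sets sparse along blocks\<close>

text \<open>
  The naturals from 2 on are cut into consecutive blocks. Block \<open>i\<close> is longer than the \<open>i\<close>-th
  power of its left end point, and all earlier blocks together have fewer elements than that end
  point. So the number of elements of a subset of one block, measured up to polynomial factors in
  the left end point, cannot be affected by what happens in earlier blocks.
\<close>
primrec block_start :: "nat \<Rightarrow> nat" where
  "block_start 0 = 2"
| "block_start (Suc i) = block_start i + block_start i ^ i + 1"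

definition block :: "nat \<Rightarrow> nat set" where
  "block i = {block_start i..<block_start (Suc i)}"

text \<open>
  For infinite \<open>S\<close> the block-sparse sets form a proper ideal. Only the blocks with index in
  \<open>S\<close> count, which is what makes the ideals of almost disjoint index sets unrelated.
\<close>
definition block_sparse :: "nat set \<Rightarrow> nat set \<Rightarrow> bool" where
  "block_sparse S A \<longleftrightarrow> (\<exists>c. \<forall>i\<in>S. card (A \<inter> block i) \<le> block_start i ^ c)"

lemma block_start_ge_2: "2 \<le> block_start i"
  by (induction i) auto

lemma strict_mono_block_start: "strict_mono block_start"
  unfolding strict_mono_Suc_iff by simp

lemma block_start_mono: "i \<le> j \<Longrightarrow> block_start i \<le> block_start j"
  using strict_mono_block_start by (simp add: strict_mono_less_eq)

lemma Suc_le_block_start: "Suc i \<le> block_start i"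
proof (induction i)
  case (Suc i)
  then show ?case by simp
qed simp

lemma finite_block [simp]: "finite (block i)"
  by (simp add: block_def)

lemma block_start_power_mono: "c \<le> d \<Longrightarrow> block_start i ^ c \<le> block_start i ^ d"
  using block_start_ge_2[of i] by (intro power_increasing) auto

lemma block_unique:
  assumes "n \<in> block i" "n \<in> block j"
  shows "i = j"
proof (rule ccontr)
  assume "i \<noteq> j"
  then consider "Suc i \<le> j" | "Suc j \<le> i" by linarith
  then show False
  proof cases
    case 1
    from block_start_mono[OF 1] assms show False by (simp add: block_def)
  next
    case 2
    from block_start_mono[OF 2] assms show False by (simp add: block_def)
  qed
qed

lemma block_sparse_subset:
  assumes "block_sparse S B" "A \<subseteq> B"
  shows "block_sparse S A"
proof -
  obtain c where "\<forall>i\<in>S. card (B \<inter> block i) \<le> block_start i ^ c"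
    using assms(1) by (auto simp: block_sparse_def)
  moreover have "card (A \<inter> block i) \<le> card (B \<inter> block i)" for i
    using assms(2) by (intro card_mono) auto
  ultimately show ?thesis
    unfolding block_sparse_def using order.trans by blast
qed

lemma block_sparse_Un:
  assumes "block_sparse S A" "block_sparse S B"
  shows "block_sparse S (A \<union> B)"
proof -
  obtain c d where c: "\<forall>i\<in>S. card (A \<inter> block i) \<le> block_start i ^ c"
    and d: "\<forall>i\<in>S. card (B \<inter> block i) \<le> block_start i ^ d"
    using assms by (auto simp: block_sparse_def)
  have "card ((A \<union> B) \<inter> block i) \<le> block_start i ^ Suc (max c d)" if "i \<in> S" for i
  proof -
    have "card ((A \<union> B) \<inter> block i) \<le> card (A \<inter> block i) + card (B \<inter> block i)"
      by (simp add: Int_Un_distrib2 card_Un_le)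
    also have "\<dots> \<le> block_start i ^ max c d + block_start i ^ max c d"
      using c d that block_start_power_mono[of c "max c d" i] block_start_power_mono[of d "max c d" i]
      by fastforce
    also have "\<dots> \<le> block_start i ^ Suc (max c d)"
      unfolding power_Suc mult_2[symmetric] by (intro mult_le_mono1 block_start_ge_2)
    finally show ?thesis .
  qed
  then show ?thesis unfolding block_sparse_def by blast
qed

lemma finite_imp_block_sparse:
  assumes "finite A"
  shows "block_sparse S A"
proof -
  have "card (A \<inter> block i) \<le> block_start i ^ card A" for i
  proof -
    have "card (A \<inter> block i) \<le> card A"
      using assms by (intro card_mono) auto
    also have "\<dots> \<le> 2 ^ card A"
      by (simp add: less_imp_le)
    also have "\<dots> \<le> block_start i ^ card A"
      using block_start_ge_2 by (intro power_mono) auto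
    finally show ?thesis .
  qed
  then show ?thesis unfolding block_sparse_def by blast
qed

lemma not_block_sparse_UNIV:
  assumes "infinite S"
  shows "\<not> block_sparse S UNIV"
proof
  assume "block_sparse S UNIV"
  then obtain c where c: "\<forall>i\<in>S. card (block i) \<le> block_start i ^ c"
    by (auto simp: block_sparse_def)
  obtain i where i: "i \<in> S" "c \<le> i"
    using assms by (meson infinite_nat_iff_unbounded_le)
  have "block_start i ^ c < card (block i)"
    using block_start_power_mono[OF i(2), of i] by (simp add: block_def)
  with c i(1) show False by force
qed

text \<open>
  If \<open>a\<close> grows past the block starts, then each block contains values only for arguments up to
  its own index, hence few of them. This is the source of small infinite sets.
\<close>
lemma block_sparse_range:
  assumes "\<And>j. block_start j \<le> a j"
  shows "block_sparse S (range a)"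
proof -
  have "card (range a \<inter> block i) \<le> block_start i ^ 1" for i
  proof -
    have "range a \<inter> block i \<subseteq> a ` {..i}"
    proof
      fix n assume n: "n \<in> range a \<inter> block i"
      then obtain j where j: "n = a j" by blast
      have "\<not> Suc i \<le> j"
      proof
        assume "Suc i \<le> j"
        from block_start_mono[OF this] assms[of j] n j show False by (simp add: block_def)
      qed
      with j show "n \<in> a ` {..i}" by auto
    qed
    then have "card (range a \<inter> block i) \<le> card (a ` {..i})"
      by (intro card_mono) auto
    also have "\<dots> \<le> Suc i"
      using card_image_le[of "{..i}" a] by simp
    finally show ?thesis using Suc_le_block_start[of i] by simp
  qed
  then show ?thesis unfolding block_sparse_def by blast
qed

text \<open>
  Tallness of the ideal.
\<close>
lemma infinite_block_sparse_subset:
  assumes "infinite D"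
  obtains E where "E \<subseteq> D" "infinite E" "block_sparse S E"
proof -
  have "\<forall>j. \<exists>n. n \<in> D \<and> block_start j \<le> n"
    using assms by (meson infinite_nat_iff_unbounded_le)
  then obtain a where a: "\<And>j. a j \<in> D" "\<And>j. block_start j \<le> a j"
    by metis
  have "infinite (range a)"
    unfolding infinite_nat_iff_unbounded_le
  proof
    fix m
    have "m \<le> a m"
      using Suc_le_block_start[of m] a(2)[of m] by linarith
    then show "\<exists>n\<ge>m. n \<in> range a" by blast
  qed
  with a that[of "range a"] block_sparse_range[of a S] show thesis by blast
qed

text \<open>
  A map that sends each block below itself has large fibres by the pigeonhole principle: at most
  \<open>block_start i\<close> values are available on block \<open>i\<close>, so some fibre holds at least the
  fraction \<open>1 / block_start i\<close> of the points. One such value per exponent suffices for a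
  non-sparse preimage, and these values can be taken to grow quickly unless finitely many values
  already have a non-sparse preimage.
\<close>
lemma not_block_sparse_downward_preimage:
  assumes N: "\<not> block_sparse S N"
    and down: "\<And>n i. n \<in> N \<Longrightarrow> n \<in> block i \<Longrightarrow> m n < block_start i"
  shows "\<exists>A. block_sparse S' A \<and> \<not> block_sparse S {n \<in> N. m n \<in> A}"
proof (cases "\<exists>j. \<not> block_sparse S {n \<in> N. m n < block_start j}")
  case True
  then obtain j where "\<not> block_sparse S {n \<in> N. m n < block_start j}" ..
  then have "\<not> block_sparse S {n \<in> N. m n \<in> {..<block_start j}}" by simp
  then show ?thesis using finite_imp_block_sparse[of "{..<block_start j}"] by blast
next
  case False
  \<comment> \<open>Removing the sparse preimage of \<open>{..<block_start j}\<close> leaves a non-sparse set, so the value with a large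
    fibre can be taken at least \<open>block_start j\<close>. The exponent \<open>Suc j\<close> below leaves room for
    the factor lost by the pigeonhole principle.\<close>
  have "\<forall>j. \<exists>a i. block_start j \<le> a \<and> i \<in> S \<and>
          block_start i ^ j < card ({n \<in> N. m n = a} \<inter> block i)"
  proof
    fix j
    let ?M = "{n \<in> N. block_start j \<le> m n}"
    have "N \<subseteq> ?M \<union> {n \<in> N. m n < block_start j}" by auto
    with N False have "\<not> block_sparse S ?M"
      by (meson block_sparse_Un block_sparse_subset)
    then obtain i where i: "i \<in> S" "block_start i ^ Suc j < card (?M \<inter> block i)"
      unfolding block_sparse_def by (metis not_le)
    have "\<exists>a\<in>{..<block_start i}. block_start i ^ j < card (m -` {a} \<inter> (?M \<inter> block i))"
    proof (rule ccontr)
      assume small: "\<not> ?thesis"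
      have "?M \<inter> block i = (\<Union>a<block_start i. m -` {a} \<inter> (?M \<inter> block i))"
        using down by auto
      then have "card (?M \<inter> block i) \<le> (\<Sum>a<block_start i. card (m -` {a} \<inter> (?M \<inter> block i)))"
        using card_UN_le[of "{..<block_start i}" "\<lambda>a. m -` {a} \<inter> (?M \<inter> block i)"] by simp
      also have "\<dots> \<le> (\<Sum>a<block_start i. block_start i ^ j)"
        using small by (intro sum_mono) (auto simp: not_less)
      finally show False using i(2) by simp
    qed
    then obtain a where a: "block_start i ^ j < card (m -` {a} \<inter> (?M \<inter> block i))" ..
    then have "m -` {a} \<inter> (?M \<inter> block i) \<noteq> {}"
      by (metis card.empty not_less_zero)
    then have "block_start j \<le> a" by auto
    moreover have "card (m -` {a} \<inter> (?M \<inter> block i)) \<le> card ({n \<in> N. m n = a} \<inter> block i)"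
      by (intro card_mono) auto
    ultimately show "\<exists>a i. block_start j \<le> a \<and> i \<in> S \<and>
          block_start i ^ j < card ({n \<in> N. m n = a} \<inter> block i)"
      using i(1) a by (meson order.strict_trans2)
  qed
  from choice[OF this] obtain a where "\<forall>j. \<exists>i. block_start j \<le> a j \<and> i \<in> S \<and>
      block_start i ^ j < card ({n \<in> N. m n = a j} \<inter> block i)" by blast
  from choice[OF this] obtain i where ai: "\<And>j. block_start j \<le> a j" "\<And>j. i j \<in> S"
    "\<And>j. block_start (i j) ^ j < card ({n \<in> N. m n = a j} \<inter> block (i j))"
    by blast
  have "\<not> block_sparse S {n \<in> N. m n \<in> range a}"
  proof
    assume "block_sparse S {n \<in> N. m n \<in> range a}"
    then obtain c where c: "\<forall>i\<in>S. card ({n \<in> N. m n \<in> range a} \<inter> block i) \<le> block_start i ^ c"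
      unfolding block_sparse_def by blast
    have "card ({n \<in> N. m n = a c} \<inter> block (i c)) \<le> card ({n \<in> N. m n \<in> range a} \<inter> block (i c))"
      by (intro card_mono) auto
    with c ai(2)[of c] ai(3)[of c] show False by force
  qed
  with block_sparse_range[of a, OF ai(1)] show ?thesis by blast
qed

text \<open>
  No map on a positive set reduces the ideal of \<open>S'\<close> to the ideal of \<open>S\<close>. The domain is split
  according to where \<open>m\<close> sends a point of block \<open>i\<close>. Points sent to later blocks have a sparse
  image, as block \<open>j\<close> receives at most as many values as there are numbers below it. Points sent to
  earlier blocks are handled by the preceding lemma. Points sent to the same block matter only for
  the finitely many \<open>i \<in> S \<inter> S'\<close>.
\<close>
lemma almost_disjoint_block_sparse_incomparable:
  assumes fin: "finite (S \<inter> S')"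
    and N: "\<not> block_sparse S N"
  shows "\<exists>A. block_sparse S' A \<and> \<not> block_sparse S {n \<in> N. m n \<in> A}"
proof (rule ccontr)
  assume "\<not> ?thesis"
  then have pre: "block_sparse S {n \<in> N. m n \<in> A}" if "block_sparse S' A" for A
    using that by blast
  let ?off = "- (\<Union>i\<in>S. block i)"
  let ?same = "\<Union>i\<in>S \<inter> S'. block i"
  let ?off' = "- (\<Union>i\<in>S'. block i)"
  let ?up = "{n \<in> N. \<exists>i. n \<in> block i \<and> block_start (Suc i) \<le> m n}"
  let ?down = "{n \<in> N. \<forall>i. n \<in> block i \<longrightarrow> m n < block_start i}"
  have off: "block_sparse R (- (\<Union>i\<in>R. block i))" for R
  proof -
    have "card (- (\<Union>i\<in>R. block i) \<inter> block j) \<le> block_start j ^ 0" if "j \<in> R" for j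
    proof -
      have "- (\<Union>i\<in>R. block i) \<inter> block j = {}" using that by auto
      then show ?thesis by (metis card.empty le0)
    qed
    then show ?thesis unfolding block_sparse_def by blast
  qed
  have same: "block_sparse S ?same"
    using fin by (intro finite_imp_block_sparse) auto
  have up: "block_sparse S ?up"
  proof -
    have "card (m ` ?up \<inter> block j) \<le> block_start j ^ 1" for j
    proof -
      have "m ` ?up \<inter> block j \<subseteq> m ` {..<block_start j}"
      proof
        fix k assume k: "k \<in> m ` ?up \<inter> block j"
        then obtain n i where n: "k = m n" "n \<in> block i" "block_start (Suc i) \<le> m n" by blast
        have "\<not> j \<le> i"
        proof
          assume "j \<le> i"
          from block_start_mono[of "Suc j" "Suc i"] this n k show False
            by (simp add: block_def)
        qed
        then have "block_start (Suc i) \<le> block_start j"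
          by (intro block_start_mono) simp
        with n show "k \<in> m ` {..<block_start j}" by (auto simp: block_def)
      qed
      then have "card (m ` ?up \<inter> block j) \<le> card (m ` {..<block_start j})"
        by (intro card_mono) auto
      also have "\<dots> \<le> block_start j"
        using card_image_le[of "{..<block_start j}" m] by simp
      finally show ?thesis by simp
    qed
    then have "block_sparse S' (m ` ?up)" unfolding block_sparse_def by blast
    from pre[OF this] show ?thesis by (rule block_sparse_subset) auto
  qed
  have down: "block_sparse S ?down"
  proof (rule ccontr)
    assume "\<not> block_sparse S ?down"
    then obtain A where A: "block_sparse S' A" "\<not> block_sparse S {n \<in> ?down. m n \<in> A}"
      using not_block_sparse_downward_preimage[of S ?down m S'] by blast
    have "{n \<in> ?down. m n \<in> A} \<subseteq> {n \<in> N. m n \<in> A}" by auto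
    with pre[OF A(1)] A(2) show False
      using block_sparse_subset by blast
  qed
  have "N \<subseteq> ?off \<union> (?same \<union> ({n \<in> N. m n \<in> ?off'} \<union> (?up \<union> ?down)))"
  proof
    fix n assume n: "n \<in> N"
    show "n \<in> ?off \<union> (?same \<union> ({n \<in> N. m n \<in> ?off'} \<union> (?up \<union> ?down)))"
    proof (cases "\<exists>i\<in>S. n \<in> block i")
      case True
      then obtain i where i: "i \<in> S" "n \<in> block i" by blast
      have uniq: "j = i" if "n \<in> block j" for j
        using that i(2) by (rule block_unique)
      have "m n < block_start i \<or> m n \<in> block i \<or> block_start (Suc i) \<le> m n"
        by (auto simp: block_def)
      then consider "m n < block_start i" | "m n \<in> block i" | "block_start (Suc i) \<le> m n"
        by blast
      then show ?thesis
      proof cases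
        case 1
        with uniq n show ?thesis by blast
      next
        case 2
        have uniq': "j = i" if "m n \<in> block j" for j
          using that 2 by (rule block_unique)
        show ?thesis
        proof (cases "i \<in> S'")
          case True
          with i show ?thesis by blast
        next
          case False
          with uniq' n have "m n \<in> ?off'" by blast
          with n show ?thesis by blast
        qed
      next
        case 3
        with i n show ?thesis by blast
      qed
    qed blast
  qed
  moreover have "block_sparse S (?off \<union> (?same \<union> ({n \<in> N. m n \<in> ?off'} \<union> (?up \<union> ?down))))"
    by (intro block_sparse_Un off same pre up down)
  ultimately show False using N block_sparse_subset by blast
qed


section \<open>Refining a topology along block-sparse ideals\<close>

definition block_refined_topology ::
    "'a topology \<Rightarrow> ('a \<Rightarrow> nat \<Rightarrow> 'a set) \<Rightarrow> ('a \<Rightarrow> nat set) \<Rightarrow> 'a topology" where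
  "block_refined_topology T U S =
     topology (\<lambda>G. G \<subseteq> topspace T \<and> (\<forall>x\<in>G. block_sparse (S x) {n. \<not> U x n \<subseteq> G}))"

lemma openin_block_refined_topology:
  "openin (block_refined_topology T U S) G \<longleftrightarrow>
     G \<subseteq> topspace T \<and> (\<forall>x\<in>G. block_sparse (S x) {n. \<not> U x n \<subseteq> G})"
proof -
  have "istopology (\<lambda>G. G \<subseteq> topspace T \<and> (\<forall>x\<in>G. block_sparse (S x) {n. \<not> U x n \<subseteq> G}))"
    unfolding istopology_def
  proof (intro conjI allI impI; (elim conjE)?)
    fix G H
    assume G: "\<forall>x\<in>G. block_sparse (S x) {n. \<not> U x n \<subseteq> G}"
      and H: "\<forall>x\<in>H. block_sparse (S x) {n. \<not> U x n \<subseteq> H}"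
    show "\<forall>x\<in>G \<inter> H. block_sparse (S x) {n. \<not> U x n \<subseteq> G \<inter> H}"
    proof
      fix x assume x: "x \<in> G \<inter> H"
      have "{n. \<not> U x n \<subseteq> G \<inter> H} = {n. \<not> U x n \<subseteq> G} \<union> {n. \<not> U x n \<subseteq> H}" by auto
      with x G H show "block_sparse (S x) {n. \<not> U x n \<subseteq> G \<inter> H}"
        by (simp add: block_sparse_Un)
    qed
  next
    fix \<G>
    assume \<G>: "\<forall>G\<in>\<G>. G \<subseteq> topspace T \<and> (\<forall>x\<in>G. block_sparse (S x) {n. \<not> U x n \<subseteq> G})"
    then show "\<Union>\<G> \<subseteq> topspace T" by blast
    show "\<forall>x\<in>\<Union>\<G>. block_sparse (S x) {n. \<not> U x n \<subseteq> \<Union>\<G>}"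
    proof
      fix x assume "x \<in> \<Union>\<G>"
      then obtain G where G: "G \<in> \<G>" "x \<in> G" by blast
      with \<G> have "block_sparse (S x) {n. \<not> U x n \<subseteq> G}" by blast
      then show "block_sparse (S x) {n. \<not> U x n \<subseteq> \<Union>\<G>}"
        by (rule block_sparse_subset) (use G in blast)
    qed
  qed auto
  then show ?thesis
    by (simp add: block_refined_topology_def topology_inverse')
qed

locale block_refinement =
  fixes T :: "'a topology" and U :: "'a \<Rightarrow> nat \<Rightarrow> 'a set" and S :: "'a \<Rightarrow> nat set"
  assumes Hausdorff: "Hausdorff_space T"
    and openin_U: "x \<in> topspace T \<Longrightarrow> openin T (U x n)"
    and disjoint_U: "x \<in> topspace T \<Longrightarrow> m \<noteq> n \<Longrightarrow> U x m \<inter> U x n = {}"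
    and U_converges: "openin T W \<Longrightarrow> x \<in> W \<Longrightarrow> finite {n. \<not> U x n \<subseteq> W}"
    and infinite_S: "x \<in> topspace T \<Longrightarrow> infinite (S x)"
    and almost_disjoint_S:
      "x \<in> topspace T \<Longrightarrow> y \<in> topspace T \<Longrightarrow> x \<noteq> y \<Longrightarrow> finite (S x \<inter> S y)"
begin

abbreviation T' :: "'a topology" where
  "T' \<equiv> block_refined_topology T U S"

lemma openin_refined: "openin T W \<Longrightarrow> openin T' W"
  by (auto simp: openin_block_refined_topology openin_subset
      intro!: finite_imp_block_sparse U_converges)

lemma topspace_refined [simp]: "topspace T' = topspace T"
proof
  show "topspace T' \<subseteq> topspace T"
    using openin_topspace[of T'] unfolding openin_block_refined_topology by (rule conjunct1)
  show "topspace T \<subseteq> topspace T'"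
    using openin_refined[OF openin_topspace] by (rule openin_subset)
qed

lemma Hausdorff_refined: "Hausdorff_space T'"
  unfolding Hausdorff_space_def topspace_refined
proof (intro allI impI)
  fix x y assume "x \<in> topspace T \<and> y \<in> topspace T \<and> x \<noteq> y"
  from Hausdorff[unfolded Hausdorff_space_def, rule_format, OF this]
  obtain G H where "openin T G" "openin T H" "x \<in> G" "y \<in> H" "disjnt G H" by blast
  then show "\<exists>G H. openin T' G \<and> openin T' H \<and> x \<in> G \<and> y \<in> H \<and> disjnt G H"
    using openin_refined by blast
qed

lemma closedin_singleton: "x \<in> topspace T \<Longrightarrow> closedin T' {x}"
  using Hausdorff_refined by (simp add: closedin_Hausdorff_singleton)

text \<open>
  The points of \<open>V\<close> cause no difficulty because \<open>V\<close> is open in the original topology; only the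
  condition at \<open>x\<close> remains.
\<close>
lemma openin_refined_insert:
  assumes V: "openin T V" and x: "x \<in> topspace T"
    and sp: "block_sparse (S x) {n. \<not> U x n \<subseteq> insert x V}"
  shows "openin T' (insert x V)"
  unfolding openin_block_refined_topology
proof (intro conjI ballI)
  show "insert x V \<subseteq> topspace T" using V x openin_subset by blast
  fix y assume y: "y \<in> insert x V"
  show "block_sparse (S y) {n. \<not> U y n \<subseteq> insert x V}"
  proof (cases "y = x")
    case False
    with y V have "finite {n. \<not> U y n \<subseteq> V}" by (intro U_converges) auto
    then show ?thesis
      by (rule block_sparse_subset[OF finite_imp_block_sparse]) auto
  qed (use sp in simp)
qed

lemma openin_refined_nhd:
  assumes "x \<in> topspace T" "block_sparse (S x) A"
  shows "openin T' (insert x (\<Union>n\<in>-A. U x n))"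
proof (rule openin_refined_insert)
  show "openin T (\<Union>n\<in>-A. U x n)" using assms openin_U by auto
  show "block_sparse (S x) {n. \<not> U x n \<subseteq> insert x (\<Union>n\<in>-A. U x n)}"
    using assms(2) by (rule block_sparse_subset) auto
qed fact

lemma open_refinement: "open_refinement T T'"
  unfolding open_refinement_def
proof (intro conjI allI impI; (elim conjE)?)
  fix V V' x assume V: "openin T V" "openin T' V'" and x: "x \<in> V \<inter> V'"
  let ?A = "{n. \<not> U x n \<subseteq> V \<inter> V'}"
  have xT: "x \<in> topspace T" using V(1) x openin_subset by blast
  have "openin T' (V \<inter> V')" using V openin_refined by blast
  with x have "block_sparse (S x) ?A" unfolding openin_block_refined_topology by blast
  from openin_refined_nhd[OF xT this]
  have "openin T' ({x} \<union> (\<Union>n\<in>-?A. U x n))" by simp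
  moreover have "openin T (\<Union>n\<in>-?A. U x n)" using openin_U xT by blast
  ultimately show "\<exists>W. openin T W \<and> W \<subseteq> V \<inter> V' \<and> openin T' ({x} \<union> W)"
    by (intro exI[of _ "\<Union>n\<in>-?A. U x n"]) auto
qed simp

text \<open>
  An infinite compact set \<open>K\<close> accumulates at some \<open>x\<close>, so it meets \<open>U x n\<close> for all \<open>n\<close> in an
  infinite set \<open>D\<close>. By tallness \<open>D\<close> contains an infinite small set \<open>E\<close>. One point of
  \<open>K \<inter> U x n\<close> for each \<open>n \<in> E\<close> gives an infinite set that converges to \<open>x\<close> in the original
  topology, so it accumulates at no other point, while smallness of \<open>E\<close> keeps it away from \<open>x\<close>
  in the refinement.
\<close>
lemma anticompact_refined: "anticompact_space T'"
  unfolding anticompact_space_def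
proof (intro allI impI)
  fix K assume K: "compactin T' K"
  have KT: "K \<subseteq> topspace T" using compactin_subset_topspace[OF K] by simp
  have accumulates: "K \<inter> T' derived_set_of Z \<noteq> {}" if "infinite Z" "Z \<subseteq> K" for Z
    using compactin_imp_Bolzano_Weierstrass[OF K] that by blast
  show "finite K"
  proof (rule ccontr)
    assume "infinite K"
    then obtain x where x: "x \<in> K" "x \<in> T' derived_set_of K"
      using accumulates[of K] by blast
    have xT: "x \<in> topspace T" using x KT by blast
    define D where "D = {n. U x n \<inter> K \<noteq> {}}"
    have "\<not> block_sparse (S x) D"
    proof
      assume "block_sparse (S x) D"
      from openin_refined_nhd[OF xT this] x(2)
      obtain y where "y \<noteq> x" "y \<in> K" "y \<in> insert x (\<Union>n\<in>-D. U x n)"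
        unfolding in_derived_set_of by blast
      then show False by (auto simp: D_def)
    qed
    then have "infinite D" using finite_imp_block_sparse by blast
    then obtain E where E: "E \<subseteq> D" "infinite E" "block_sparse (S x) E"
      by (rule infinite_block_sparse_subset)
    have "\<forall>n\<in>E. \<exists>v. v \<in> U x n \<inter> K" using E(1) unfolding D_def by blast
    from bchoice[OF this] obtain z where z: "\<And>n. n \<in> E \<Longrightarrow> z n \<in> U x n \<inter> K" by blast
    have inj: "inj_on z E"
    proof (rule inj_onI, rule ccontr)
      fix m n assume mn: "m \<in> E" "n \<in> E" "z m = z n" "m \<noteq> n"
      with z[of m] z[of n] disjoint_U[OF xT mn(4)] show False by auto
    qed
    then have "infinite (z ` E)" using E(2) by (simp add: finite_image_iff)
    moreover have "z ` E \<subseteq> K" using z by blast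
    ultimately obtain y where y: "y \<in> K" "y \<in> T' derived_set_of (z ` E)"
      using accumulates by blast
    show False
    proof (cases "y = x")
      case True
      with openin_refined_nhd[OF xT E(3)] y(2)
      obtain n where n: "n \<in> E" "z n \<noteq> x" "z n \<in> insert x (\<Union>n\<in>-E. U x n)"
        unfolding in_derived_set_of by blast
      then obtain m where m: "m \<notin> E" "z n \<in> U x m" by blast
      with n z[of n] disjoint_U[OF xT, of m n] show False by blast
    next
      case False
      moreover have "y \<in> topspace T" using y(1) KT by blast
      ultimately obtain G H
        where GH: "openin T G" "openin T H" "y \<in> G" "x \<in> H" "disjnt G H"
        using Hausdorff[unfolded Hausdorff_space_def, rule_format, of y x] xT by blast
      have "z ` E \<inter> G \<subseteq> z ` {n. \<not> U x n \<subseteq> H}"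
      proof
        fix v assume "v \<in> z ` E \<inter> G"
        then obtain n where n: "n \<in> E" "v = z n" "z n \<in> G" by blast
        with z[of n] GH(5) have "\<not> U x n \<subseteq> H" by (auto simp: disjnt_iff)
        with n show "v \<in> z ` {n. \<not> U x n \<subseteq> H}" by blast
      qed
      moreover have "finite {n. \<not> U x n \<subseteq> H}" using GH by (intro U_converges)
      ultimately have "finite (z ` E \<inter> G)" by (meson finite_imageI finite_subset)
      moreover have "infinite (z ` E \<inter> G)"
      proof -
        have "y \<in> T' derived_set_of (z ` E)" "t1_space T'"
          using y Hausdorff_refined Hausdorff_imp_t1_space by auto
        then show ?thesis
          using GH openin_refined by (simp add: t1_space_derived_set_of_infinite_openin)
      qed
      ultimately show False by blast
    qed
  qed
qed

text \<open>
  The index map \<open>m\<close> below records which \<open>U y k\<close>, with \<open>y = f x\<close>, receives the image of a chosen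
  point of \<open>U x n\<close>. Continuity makes preimages of small sets under \<open>m\<close> small, which contradicts
  incomparability of the ideals at \<open>x\<close> and \<open>y\<close>.
\<close>
lemma locally_constant_off_fixpoints:
  assumes cont: "continuous_map (subtopology T' C) T' f"
    and x: "x \<in> C" "x \<in> topspace T" and moved: "f x \<noteq> x"
  shows "\<exists>G. openin T' G \<and> x \<in> G \<and> (\<forall>z\<in>C \<inter> G. f z = f x)"
proof (rule ccontr)
  assume not_const: "\<not> ?thesis"
  define y where "y = f x"
  have yT: "y \<in> topspace T"
    using continuous_map_image_subset_topspace[OF cont] x by (auto simp: y_def)
  \<comment> \<open>Continuity at \<open>x\<close>, expressed through the ideals at \<open>x\<close> and at \<open>y\<close>.\<close>
  have pull: "\<exists>B. block_sparse (S x) B \<and>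
      (\<forall>n z. n \<notin> B \<longrightarrow> z \<in> C \<inter> U x n \<longrightarrow> f z = y \<or> (\<exists>k. k \<notin> A \<and> f z \<in> U y k))"
    if A: "block_sparse (S y) A" for A
  proof -
    let ?V = "insert y (\<Union>k\<in>-A. U y k)"
    have "openin (subtopology T' C) {z \<in> topspace (subtopology T' C). f z \<in> ?V}"
      using cont openin_refined_nhd[OF yT A] by (rule openin_continuous_map_preimage)
    then obtain G where G: "openin T' G" "{z \<in> topspace (subtopology T' C). f z \<in> ?V} = G \<inter> C"
      unfolding openin_subtopology by blast
    have "x \<in> {z \<in> topspace (subtopology T' C). f z \<in> ?V}"
      using x by (simp add: y_def)
    then have "x \<in> G" using G(2) by blast
    with G(1) have "block_sparse (S x) {n. \<not> U x n \<subseteq> G}"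
      unfolding openin_block_refined_topology by blast
    moreover have "f z = y \<or> (\<exists>k. k \<notin> A \<and> f z \<in> U y k)"
      if "n \<notin> {n. \<not> U x n \<subseteq> G}" "z \<in> C \<inter> U x n" for n z
    proof -
      have "z \<in> G \<inter> C" using that by blast
      then have "f z \<in> ?V" unfolding G(2)[symmetric] by blast
      then show ?thesis by blast
    qed
    ultimately show ?thesis by blast
  qed
  define N where "N = {n. \<exists>z. z \<in> C \<inter> U x n \<and> f z \<noteq> y}"
  have N: "\<not> block_sparse (S x) N"
  proof
    assume "block_sparse (S x) N"
    from openin_refined_nhd[OF x(2) this] not_const
    obtain z where "z \<in> C" "z \<in> insert x (\<Union>n\<in>-N. U x n)" "f z \<noteq> f x" by blast
    then show False by (auto simp: N_def y_def)
  qed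
  have "\<forall>n\<in>N. \<exists>v. v \<in> C \<inter> U x n \<and> f v \<noteq> y" unfolding N_def by blast
  from bchoice[OF this] obtain z
    where z: "\<And>n. n \<in> N \<Longrightarrow> z n \<in> C \<inter> U x n" "\<And>n. n \<in> N \<Longrightarrow> f (z n) \<noteq> y" by blast
  define m where "m n = (SOME k. f (z n) \<in> U y k)" for n
  have "finite (S x \<inter> S y)"
    using x yT moved by (intro almost_disjoint_S) (auto simp: y_def)
  from almost_disjoint_block_sparse_incomparable[OF this N, of m]
  obtain A where A: "block_sparse (S y) A" "\<not> block_sparse (S x) {n \<in> N. m n \<in> A}" by blast
  from pull[OF A(1)] obtain B where B: "block_sparse (S x) B"
    "\<And>n v. n \<notin> B \<Longrightarrow> v \<in> C \<inter> U x n \<Longrightarrow> f v = y \<or> (\<exists>k. k \<notin> A \<and> f v \<in> U y k)" by blast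
  have "{n \<in> N. m n \<in> A} \<subseteq> B"
  proof (rule subsetI, rule ccontr)
    fix n assume n: "n \<in> {n \<in> N. m n \<in> A}" "n \<notin> B"
    with B(2)[of n "z n"] z obtain k where k: "k \<notin> A" "f (z n) \<in> U y k" by blast
    then have "f (z n) \<in> U y (m n)" unfolding m_def by (metis someI)
    with k disjoint_U[OF yT, of k "m n"] have "k = m n" by blast
    with k n show False by simp
  qed
  with A(2) B(1) show False using block_sparse_subset by blast
qed

text \<open>
  Suppose \<open>f\<close> moves \<open>c\<close> to \<open>y\<close>. Every point of the fibre of \<open>y\<close> other than \<open>y\<close> is moved by
  \<open>f\<close>, so the preceding lemma makes this fibre open in \<open>C - {y}\<close>; it is closed as well, and
  connectedness of \<open>C - {y}\<close> shows that it is everything. The value at \<open>y\<close> itself, if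
  \<open>y \<in> C\<close>, is then also \<open>y\<close>, as otherwise \<open>y\<close> would be isolated in the connected set \<open>C\<close>.
\<close>
lemma vertex_connected_continuous_map:
  assumes C: "C \<subseteq> topspace T" and vc: "vertex_connected_space (subtopology T' C)"
    and cont: "continuous_map (subtopology T' C) T' f"
  shows "f constant_on C \<or> (\<forall>c\<in>C. f c = c)"
proof (rule disjCI)
  assume "\<not> (\<forall>c\<in>C. f c = c)"
  then obtain c where c: "c \<in> C" "f c \<noteq> c" by blast
  define y where "y = f c"
  have yT: "y \<in> topspace T"
    using continuous_map_image_subset_topspace[OF cont] c C by (auto simp: y_def)
  have top: "topspace (subtopology T' C) = C" "topspace (subtopology T' (C - {y})) = C - {y}"
    using C by auto
  have conn: "connected_space (subtopology T' C)"
    using vc by (simp add: vertex_connected_space_def)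
  have conn': "connected_space (subtopology T' (C - {y}))"
  proof (cases "y \<in> C")
    case True
    then have "connected_space (subtopology (subtopology T' C) (C - {y}))"
      using vc top unfolding vertex_connected_space_def by metis
    then show ?thesis by (simp add: subtopology_subtopology Int_absorb1)
  qed (use conn in simp)
  have closed: "closedin (subtopology T' C) {z \<in> C. f z = y}"
    using closedin_continuous_map_preimage[OF cont closedin_singleton[OF yT]]
    unfolding top by simp
  let ?P = "{z \<in> C - {y}. f z = y}"
  have "openin (subtopology T' (C - {y})) ?P"
  proof (subst openin_subopen, intro ballI)
    fix x assume x: "x \<in> ?P"
    then have "x \<in> C" "x \<in> topspace T" "f x \<noteq> x" using C by auto
    from locally_constant_off_fixpoints[OF cont this] x
    obtain G where "openin T' G" "x \<in> G" "\<forall>z\<in>C \<inter> G. f z = y" by auto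
    with x show "\<exists>W. openin (subtopology T' (C - {y})) W \<and> x \<in> W \<and> W \<subseteq> ?P"
      by (intro exI[of _ "G \<inter> (C - {y})"]) (auto simp: openin_subtopology)
  qed
  moreover have "closedin (subtopology T' (C - {y})) ?P"
  proof -
    from closed obtain F where F: "closedin T' F" "{z \<in> C. f z = y} = F \<inter> C"
      by (auto simp: closedin_subtopology)
    from F(2) have "?P = F \<inter> (C - {y})" by blast
    with F(1) show ?thesis by (auto simp: closedin_subtopology)
  qed
  moreover have "c \<in> ?P" using c by (simp add: y_def)
  ultimately have P: "?P = C - {y}"
    using conn' top unfolding connected_space_clopen_in by blast
  have "f z = y" if "z \<in> C" for z
  proof (rule ccontr)
    assume nz: "f z \<noteq> y"
    with P that have zy: "z = y" by blast
    have "{z \<in> C. f z = y} = C - {y}" using P nz that zy by blast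
    with closed have "closedin (subtopology T' C) (C - {y})" by simp
    then have "openin (subtopology T' C) {y}"
      using that zy top by (simp add: openin_closedin)
    moreover have "closedin (subtopology T' C) {y}"
      using closedin_singleton[OF yT] that zy by (auto simp: closedin_subtopology)
    ultimately have "C = {y}"
      using conn top unfolding connected_space_clopen_in by auto
    with c show False by (simp add: y_def)
  qed
  then show "f constant_on C" unfolding constant_on_def by blast
qed

text \<open>
  A neighbourhood of \<open>x\<close> in the refinement contains \<open>U x n\<close> for a set of indices whose complement
  is small. Such a set is infinite because the ideal is proper and contains the finite sets, so some
  of these \<open>U x n\<close> meet \<open>V\<close>.
\<close>
lemma closure_of_refined:
  assumes "x \<in> T closure_of V" and "finite {n. U x n \<inter> V = {}}"
  shows "x \<in> T' closure_of V"
  unfolding in_closure_of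
proof (intro conjI allI impI; (elim conjE)?)
  show xT: "x \<in> topspace T'" using assms(1) by (simp add: in_closure_of)
  fix G assume "x \<in> G" "openin T' G"
  then have "block_sparse (S x) {n. \<not> U x n \<subseteq> G}"
    unfolding openin_block_refined_topology by blast
  then have "block_sparse (S x) ({n. \<not> U x n \<subseteq> G} \<union> {n. U x n \<inter> V = {}})"
    by (rule block_sparse_Un[OF _ finite_imp_block_sparse[OF assms(2)]])
  moreover have "\<not> block_sparse (S x) UNIV"
    using xT infinite_S by (intro not_block_sparse_UNIV) simp
  ultimately obtain n where "U x n \<subseteq> G" "U x n \<inter> V \<noteq> {}"
    by (metis (mono_tags, lifting) UNIV_eq_I UnCI mem_Collect_eq)
  then show "\<exists>y. y \<in> V \<and> y \<in> G" by blast
qed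

lemma brown_refined:
  assumes brown: "brown_space T"
    and meets: "\<And>V. openin T V \<Longrightarrow> V \<noteq> {} \<Longrightarrow>
      \<exists>W. openin T W \<and> W \<noteq> {} \<and> W \<subseteq> V \<and> (\<forall>x\<in>T closure_of W. finite {n. U x n \<inter> W = {}})"
    and nonempty: "\<And>x. x \<in> topspace T \<Longrightarrow> finite {n. U x n = {}}"
  shows "brown_space T'"
  unfolding brown_space_def
proof (intro allI impI; elim conjE)
  have inside: "\<exists>W. openin T W \<and> W \<noteq> {} \<and> T closure_of W \<subseteq> T' closure_of V"
    if V: "openin T' V" "V \<noteq> {}" for V
  proof -
    obtain x where x: "x \<in> V" using V by blast
    then have xT: "x \<in> topspace T" using V openin_subset by fastforce
    have "block_sparse (S x) ({n. \<not> U x n \<subseteq> V} \<union> {n. U x n = {}})"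
      using x V(1) unfolding openin_block_refined_topology
      by (intro block_sparse_Un finite_imp_block_sparse[OF nonempty[OF xT]]) blast
    moreover have "\<not> block_sparse (S x) UNIV"
      using xT infinite_S by (intro not_block_sparse_UNIV) simp
    ultimately obtain n where n: "U x n \<subseteq> V" "U x n \<noteq> {}"
      by (metis (mono_tags, lifting) UNIV_eq_I UnCI mem_Collect_eq)
    from meets[OF openin_U[OF xT] n(2)] obtain W where W: "openin T W" "W \<noteq> {}" "W \<subseteq> U x n"
      "\<forall>x\<in>T closure_of W. finite {n. U x n \<inter> W = {}}" by blast
    have "T closure_of W \<subseteq> T' closure_of W"
      using W(4) closure_of_refined by blast
    also have "\<dots> \<subseteq> T' closure_of V"
      using W(3) n(1) by (intro closure_of_mono) blast
    finally show ?thesis using W by blast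
  qed
  fix V V' assume "openin T' V" "openin T' V'" "V \<noteq> {}" "V' \<noteq> {}"
  with inside obtain W W' where W: "openin T W" "W \<noteq> {}" "T closure_of W \<subseteq> T' closure_of V"
    "openin T W'" "W' \<noteq> {}" "T closure_of W' \<subseteq> T' closure_of V'" by metis
  with brown have "infinite (T closure_of W \<inter> T closure_of W')"
    unfolding brown_space_def by blast
  then show "infinite (T' closure_of V \<inter> T' closure_of V')"
    using W by (meson Int_mono infinite_super)
qed

end

section \<open>Brown spaces\<close>

lemma brown_space_infinite_openin:
  assumes "brown_space X" "t1_space X" "openin X U" "U \<noteq> {}"
  shows "infinite U"
proof
  assume "finite U"
  with assms have "closedin X U"
    by (simp add: t1_space_closedin_finite openin_subset)
  then have "X closure_of U = U" by (simp add: closure_of_closedin)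
  with assms \<open>finite U\<close> show False unfolding brown_space_def by (metis finite_Int)
qed

text \<open>
  If two disjoint open sets cover \<open>Y\<close>, the closure of each misses the other, so their closures can
  meet only outside \<open>Y\<close>.
\<close>
lemma brown_space_connected_cofinite:
  assumes brown: "brown_space X" and Y: "openin X Y" "finite (topspace X - Y)"
  shows "connected_space (subtopology X Y)"
  unfolding connected_space_def
proof
  have YX: "Y \<subseteq> topspace X" using Y(1) by (rule openin_subset)
  assume "\<exists>U V. openin (subtopology X Y) U \<and> openin (subtopology X Y) V \<and>
    topspace (subtopology X Y) \<subseteq> U \<union> V \<and> U \<inter> V = {} \<and> U \<noteq> {} \<and> V \<noteq> {}"
  then obtain U V where UV: "openin X U" "openin X V" "Y \<subseteq> U \<union> V" "U \<inter> V = {}"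
    "U \<noteq> {}" "V \<noteq> {}"
    using Y(1) YX by (simp add: openin_open_subtopology Int_absorb1) blast
  have "X closure_of U \<inter> V = {}" "X closure_of V \<inter> U = {}"
    using UV by (auto simp: openin_Int_closure_of_eq_empty Int_commute)
  moreover have "X closure_of U \<subseteq> topspace X" by (rule closure_of_subset_topspace)
  ultimately have "X closure_of U \<inter> X closure_of V \<subseteq> topspace X - Y"
    using UV(3) by blast
  then have "finite (X closure_of U \<inter> X closure_of V)"
    using Y(2) by (rule finite_subset)
  with brown UV show False unfolding brown_space_def by blast
qed

lemma brown_space_vertex_connected:
  assumes "brown_space X" "t1_space X"
  shows "vertex_connected_space X"
  unfolding vertex_connected_space_def
proof (intro conjI ballI)
  show "connected_space X"
    using brown_space_connected_cofinite[OF assms(1) openin_topspace] by (simp add: subtopology_topspace)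
  fix x assume "x \<in> topspace X"
  with assms(2) have "closedin X {x}" by (simp add: closedin_t1_singleton)
  then have "openin X (topspace X - {x})" by (simp add: openin_diff)
  with assms(1) show "connected_space (subtopology X (topspace X - {x}))"
    by (rule brown_space_connected_cofinite) (simp add: Diff_Diff_Int)
qed

section \<open>Almost disjoint index sets and open sequences\<close>

text \<open>
  The classical almost disjoint family of branches of the binary tree: \<open>S x\<close> consists of codes for
  the initial segments of the sequence of truth values \<open>x \<in> B k\<close>. The length \<open>n\<close> is coded
  separately because a finite set does not determine the length of the segment it encodes.
\<close>
lemma almost_disjoint_branches:
  fixes B :: "nat \<Rightarrow> 'a set"
  defines "S \<equiv> \<lambda>x. range (\<lambda>n. prod_encode (n, set_encode {k. k < n \<and> x \<in> B k}))"
  shows "infinite (S x)"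
    and "(x \<in> B k) \<noteq> (y \<in> B k) \<Longrightarrow> finite (S x \<inter> S y)"
proof -
  have "inj (\<lambda>n. prod_encode (n, set_encode {k. k < n \<and> x \<in> B k}))"
    by (rule injI) simp
  then show "infinite (S x)"
    unfolding S_def by (simp add: finite_image_iff)
next
  assume k: "(x \<in> B k) \<noteq> (y \<in> B k)"
  have "S x \<inter> S y \<subseteq> (\<lambda>n. prod_encode (n, set_encode {k. k < n \<and> x \<in> B k})) ` {..k}"
  proof
    fix v assume "v \<in> S x \<inter> S y"
    then obtain n where n: "v = prod_encode (n, set_encode {k. k < n \<and> x \<in> B k})"
      "set_encode {k. k < n \<and> x \<in> B k} = set_encode {k. k < n \<and> y \<in> B k}"
      by (auto simp: S_def)
    from n(2) have "{k. k < n \<and> x \<in> B k} = {k. k < n \<and> y \<in> B k}"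
      by (subst (asm) set_encode_eq) auto
    with k have "\<not> k < n" by blast
    with n(1) show "v \<in> (\<lambda>n. prod_encode (n, set_encode {k. k < n \<and> x \<in> B k})) ` {..k}" by auto
  qed
  then show "finite (S x \<inter> S y)" by (rule finite_subset) simp
qed

text \<open>
  The sequence is chosen together with a decreasing sequence of neighbourhoods \<open>H\<close> of \<open>x\<close>, each
  disjoint from the open set \<open>V\<close> chosen at the same stage and containing everything chosen
  later. At stage \<open>n\<close> only finitely many basic sets must be met; one point other than \<open>x\<close> is
  taken in each of them, which is possible as there are no isolated points, and the resulting finite
  set is separated from \<open>x\<close> by the Hausdorff property.
\<close>
lemma disjoint_open_sequence_meeting_base:
  fixes B :: "nat \<Rightarrow> 'a set"
  assumes T: "Hausdorff_space T"
    and inf: "\<And>V. openin T V \<Longrightarrow> V \<noteq> {} \<Longrightarrow> infinite V"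
    and B: "\<And>i. openin T (B i)"
    and x: "x \<in> topspace T"
  obtains U where "\<And>n. openin T (U n)" "\<And>m n. m \<noteq> n \<Longrightarrow> U m \<inter> U n = {}"
    "\<And>i n. i \<le> n \<Longrightarrow> x \<in> B i \<Longrightarrow> U n \<subseteq> B i"
    "\<And>i n. i \<le> n \<Longrightarrow> x \<in> T closure_of B i \<Longrightarrow> U n \<inter> B i \<noteq> {}"
proof -
  define good where "good n V H \<longleftrightarrow> openin T V \<and> openin T H \<and> x \<in> H \<and> V \<inter> H = {} \<and>
      (\<forall>i\<le>n. x \<in> B i \<longrightarrow> V \<subseteq> B i) \<and> (\<forall>i\<le>n. x \<in> T closure_of B i \<longrightarrow> V \<inter> B i \<noteq> {})" for n V H
  have step: "\<exists>V H. good n V H \<and> V \<subseteq> G \<and> H \<subseteq> G"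
    if G: "openin T G" "x \<in> G" for G n
  proof -
    define W where "W = \<Inter>(insert G (B ` {i. i \<le> n \<and> x \<in> B i}))"
    have W: "openin T W" "x \<in> W"
    proof -
      show "openin T W"
        unfolding W_def by (rule openin_Inter) (use G B in auto)
      show "x \<in> W" using G by (auto simp: W_def)
    qed
    have "\<exists>z. z \<in> W \<inter> B i \<and> z \<noteq> x" if "x \<in> T closure_of B i" for i
    proof -
      have "W \<inter> B i \<noteq> {}" using that W unfolding in_closure_of by blast
      then have "infinite (W \<inter> B i)" using W B by (intro inf) auto
      then have "infinite (W \<inter> B i - {x})" by simp
      then show ?thesis by (metis DiffE all_not_in_conv finite.emptyI singletonI)
    qed
    then obtain z where z: "\<And>i. x \<in> T closure_of B i \<Longrightarrow> z i \<in> W \<inter> B i \<and> z i \<noteq> x"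
      by metis
    define F where "F = z ` {i. i \<le> n \<and> x \<in> T closure_of B i}"
    have F: "F \<subseteq> W - {x}" using z by (auto simp: F_def)
    have "compactin T F"
      using F W openin_subset by (intro finite_imp_compactin) (auto simp: F_def)
    moreover have "compactin T {x}" using x by simp
    moreover have "disjnt F {x}" using F by (auto simp: disjnt_iff)
    ultimately obtain V H where VH: "openin T V" "openin T H" "F \<subseteq> V" "{x} \<subseteq> H" "disjnt V H"
      using T unfolding Hausdorff_space_compact_sets by meson
    have meets: "V \<inter> W \<inter> B i \<noteq> {}" if "i \<le> n" "x \<in> T closure_of B i" for i
    proof -
      have "z i \<in> F" using that by (auto simp: F_def)
      with VH z[OF that(2)] show ?thesis by blast
    qed
    show ?thesis
      unfolding good_def
    proof (intro exI conjI allI impI)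
      show "openin T (V \<inter> W)" "openin T (H \<inter> W)" using VH W by auto
      show "x \<in> H \<inter> W" using VH W by auto
      show "V \<inter> W \<inter> (H \<inter> W) = {}" using VH by (auto simp: disjnt_iff)
      show "V \<inter> W \<subseteq> G" "H \<inter> W \<subseteq> G" by (auto simp: W_def)
      show "V \<inter> W \<subseteq> B i" if "i \<le> n" "x \<in> B i" for i using that by (auto simp: W_def)
    qed (use meets in blast)
  qed
  have "\<exists>f. \<forall>n. good n (fst (f n)) (snd (f n)) \<and>
      fst (f (Suc n)) \<subseteq> snd (f n) \<and> snd (f (Suc n)) \<subseteq> snd (f n)"
  proof (rule dependent_nat_choice)
    from step[OF openin_topspace x, of 0] obtain V H where "good 0 V H" by blast
    then show "\<exists>p. good 0 (fst p) (snd p)"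
      by (intro exI[of _ "(V, H)"]) simp
    fix p n assume "good n (fst p) (snd p)"
    then have "openin T (snd p)" "x \<in> snd p" by (auto simp: good_def)
    from step[OF this, of "Suc n"] obtain V H
      where "good (Suc n) V H" "V \<subseteq> snd p" "H \<subseteq> snd p" by blast
    then show "\<exists>q. good (Suc n) (fst q) (snd q) \<and> fst q \<subseteq> snd p \<and> snd q \<subseteq> snd p"
      by (intro exI[of _ "(V, H)"]) auto
  qed
  then obtain f where f: "\<And>n. good n (fst (f n)) (snd (f n))"
    "\<And>n. fst (f (Suc n)) \<subseteq> snd (f n)" "\<And>n. snd (f (Suc n)) \<subseteq> snd (f n)" by blast
  have decr: "snd (f n) \<subseteq> snd (f m)" if "m \<le> n" for m n
    using that by (induction rule: dec_induct) (use f(3) in auto)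
  have disj: "fst (f m) \<inter> fst (f n) = {}" if less: "m < n" for m n
  proof -
    obtain k where k: "n = Suc k" "m \<le> k" using less by (cases n) auto
    have "fst (f n) \<subseteq> snd (f m)" using f(2)[of k] decr[OF k(2)] k(1) by blast
    moreover have "fst (f m) \<inter> snd (f m) = {}" using f(1)[of m] by (simp add: good_def)
    ultimately show ?thesis by blast
  qed
  show thesis
  proof (rule that[of "\<lambda>n. fst (f n)"])
    show "fst (f m) \<inter> fst (f n) = {}" if "m \<noteq> n" for m n
      using disj[of m n] disj[of n m] that by (metis Int_commute linorder_neqE_nat)
  qed (use f(1) in \<open>auto simp: good_def\<close>)
qed

section \<open>Existence of the refinement\<close>

theorem theorem1p3:
  fixes T :: "'a topology"
  assumes "second_countable T"
    and "brown_space T"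
    and "Hausdorff_space T"
  shows "\<exists>T'. open_refinement T T' \<and>
           brown_space T' \<and> anticompact_space T' \<and> strongly_rigid_space T' \<and>
           (\<forall>C f. C \<subseteq> topspace T' \<and> vertex_connected_space (subtopology T' C) \<and>
                  continuous_map (subtopology T' C) T' f \<longrightarrow>
              f constant_on C \<or> (\<forall>c\<in>C. f c = c))"
proof -
  obtain \<B> where \<B>: "countable \<B>" "\<And>V. V \<in> \<B> \<Longrightarrow> openin T V"
    "\<And>V x. openin T V \<Longrightarrow> x \<in> V \<Longrightarrow> \<exists>W\<in>\<B>. x \<in> W \<and> W \<subseteq> V"
    using assms(1) unfolding second_countable_def by (metis (no_types, lifting))
  \<comment> \<open>The empty set is added so that the enumeration makes sense for an empty base.\<close>
  define B where "B = from_nat_into (insert {} \<B>)"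
  have B_open: "openin T (B i)" for i
    using from_nat_into[of "insert {} \<B>" i] \<B>(2) by (auto simp: B_def)
  have B_base: "\<exists>i. x \<in> B i \<and> B i \<subseteq> V" if V: "openin T V" "x \<in> V" for V x
  proof -
    obtain W where W: "W \<in> \<B>" "x \<in> W" "W \<subseteq> V" using \<B>(3)[OF V] by blast
    then obtain i where "B i = W"
      using from_nat_into_surj[of "insert {} \<B>" W] \<B>(1) by (auto simp: B_def)
    with W show ?thesis by blast
  qed
  have inf: "infinite V" if "openin T V" "V \<noteq> {}" for V
    using brown_space_infinite_openin assms(2,3) that Hausdorff_imp_t1_space by blast
  have "\<exists>U. (\<forall>n. openin T (U n)) \<and> (\<forall>m n. m \<noteq> n \<longrightarrow> U m \<inter> U n = {}) \<and>
      (\<forall>i n. i \<le> n \<longrightarrow> x \<in> B i \<longrightarrow> U n \<subseteq> B i) \<and>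
      (\<forall>i n. i \<le> n \<longrightarrow> x \<in> T closure_of B i \<longrightarrow> U n \<inter> B i \<noteq> {})"
    if "x \<in> topspace T" for x
    by (rule disjoint_open_sequence_meeting_base[where B = B, OF assms(3) inf B_open that]) blast+
  then have "\<forall>x\<in>topspace T. \<exists>U. (\<forall>n. openin T (U n)) \<and> (\<forall>m n. m \<noteq> n \<longrightarrow> U m \<inter> U n = {}) \<and>
      (\<forall>i n. i \<le> n \<longrightarrow> x \<in> B i \<longrightarrow> U n \<subseteq> B i) \<and>
      (\<forall>i n. i \<le> n \<longrightarrow> x \<in> T closure_of B i \<longrightarrow> U n \<inter> B i \<noteq> {})" by blast
  from bchoice[OF this] obtain U where "\<forall>x\<in>topspace T.
      (\<forall>n. openin T (U x n)) \<and> (\<forall>m n. m \<noteq> n \<longrightarrow> U x m \<inter> U x n = {}) \<and>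
      (\<forall>i n. i \<le> n \<longrightarrow> x \<in> B i \<longrightarrow> U x n \<subseteq> B i) \<and>
      (\<forall>i n. i \<le> n \<longrightarrow> x \<in> T closure_of B i \<longrightarrow> U x n \<inter> B i \<noteq> {})" ..
  then have U:
    "\<And>x n. x \<in> topspace T \<Longrightarrow> openin T (U x n)"
    "\<And>x m n. x \<in> topspace T \<Longrightarrow> m \<noteq> n \<Longrightarrow> U x m \<inter> U x n = {}"
    "\<And>x i n. x \<in> topspace T \<Longrightarrow> i \<le> n \<Longrightarrow> x \<in> B i \<Longrightarrow> U x n \<subseteq> B i"
    "\<And>x i n. x \<in> topspace T \<Longrightarrow> i \<le> n \<Longrightarrow> x \<in> T closure_of B i \<Longrightarrow> U x n \<inter> B i \<noteq> {}"
    by simp_all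
  define S where "S x = range (\<lambda>n. prod_encode (n, set_encode {k. k < n \<and> x \<in> B k}))" for x
  interpret block_refinement T U S
  proof
    show "finite {n. \<not> U x n \<subseteq> W}" if W: "openin T W" "x \<in> W" for W x
    proof -
      have xT: "x \<in> topspace T" using W openin_subset by blast
      obtain i where i: "x \<in> B i" "B i \<subseteq> W" using B_base[OF W] by blast
      have "{n. \<not> U x n \<subseteq> W} \<subseteq> {..<i}"
      proof (rule subsetI, rule ccontr)
        fix n assume "n \<in> {n. \<not> U x n \<subseteq> W}" "n \<notin> {..<i}"
        with U(3)[OF xT, of i n] i show False by auto
      qed
      then show ?thesis by (rule finite_subset) simp
    qed
    show "finite (S x \<inter> S y)" if xy: "x \<in> topspace T" "y \<in> topspace T" "x \<noteq> y" for x y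
    proof -
      obtain V W where "openin T V" "openin T W" "x \<in> V" "y \<in> W" "disjnt V W"
        using assms(3)[unfolded Hausdorff_space_def, rule_format, of x y] xy by blast
      moreover then obtain k where "x \<in> B k" "B k \<subseteq> V" using B_base by blast
      ultimately have "(x \<in> B k) \<noteq> (y \<in> B k)" by (auto simp: disjnt_iff)
      then show ?thesis unfolding S_def by (rule almost_disjoint_branches)
    qed
    show "infinite (S x)" if "x \<in> topspace T" for x
      unfolding S_def by (rule almost_disjoint_branches)
  qed (use assms U in auto)
  have meets: "finite {n. U x n \<inter> B i = {}}" if "x \<in> T closure_of B i" for x i
  proof -
    have "x \<in> topspace T" using that by (simp add: in_closure_of)
    then have "{n. U x n \<inter> B i = {}} \<subseteq> {..<i}"
      using U(4) that by (metis (mono_tags, lifting) lessThan_iff mem_Collect_eq not_le subsetI)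
    then show ?thesis by (rule finite_subset) simp
  qed
  have brown: "brown_space T'"
  proof (rule brown_refined)
    fix V assume V: "openin T V" "V \<noteq> {}"
    then obtain i where "B i \<noteq> {}" "B i \<subseteq> V" using B_base by blast
    then show "\<exists>W. openin T W \<and> W \<noteq> {} \<and> W \<subseteq> V \<and>
        (\<forall>x\<in>T closure_of W. finite {n. U x n \<inter> W = {}})"
      using B_open meets by blast
  next
    fix x assume "x \<in> topspace T"
    then obtain i where "x \<in> B i" using B_base[OF openin_topspace] by blast
    then have "x \<in> T closure_of B i"
      using closure_of_subset[OF openin_subset[OF B_open[of i]]] by blast
    then have "finite {n. U x n \<inter> B i = {}}" by (rule meets)
    then show "finite {n. U x n = {}}" by (rule rev_finite_subset) auto
  qed (rule assms)
  have "strongly_rigid_space T'"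
    unfolding strongly_rigid_space_def
  proof (intro allI impI; elim conjE)
    fix f assume f: "continuous_map T' T' f" "\<not> (\<forall>x\<in>topspace T'. f x = x)"
    have "vertex_connected_space T'"
      using brown Hausdorff_refined Hausdorff_imp_t1_space brown_space_vertex_connected by blast
    then have "vertex_connected_space (subtopology T' (topspace T'))"
      by (simp only: subtopology_topspace)
    with f vertex_connected_continuous_map[of "topspace T'" f]
    show "f constant_on topspace T'" by (simp only: subtopology_topspace) simp
  qed
  with open_refinement brown anticompact_refined vertex_connected_continuous_map show ?thesis
    by (intro exI[of _ T']) simp
qed

end
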